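(* Let $n\ge1$ be an integer and $p>\frac n{n+2}$. Let $q\in\mathbb R^+\setminus\{1\}$ be such that the $q$-Rényi entropy of the densities $f_p(D,0,\cdot)$, $D\in\mathcal M_n$, is well defined (the integral $\int_{\mathbb R^n}f_p(D,0,x)^q\,dx$ exists and is finite). Then for every $D\in\mathcal M_n$ and all real symmetric $n\times n$ matrices $X,Y$, the quadratic form generated by the $q$-Rényi entropy, $$g_D^{(R)}(X,Y)=\left.\frac{\partial^2}{\partial s\,\partial t}S_q\big(f_p(D+tX+sY,0,\cdot)\big)\right|_{t=s=0},$$ satisfies $$g_D^{(R)}(X,Y)=\frac12\operatorname{Tr}(D^{-1}XD^{-1}Y).$$
   Context: $\mathcal M_n$ is the set of real symmetric strictly positive definite $n\times n$ matrices. For a density $f$ on $\mathbb R^n$ and $q\in\mathbb R^+\setminus\{1\}$, $S_q(f)=\frac1{1-q}\log\int_{\mathbb R^n}f(x)^q\,dx$. For $D\in\mathcal M_n$, $u\in\mathbb R^n$ and $p>\frac n{n+2}$, $p\ne1$, the $p$-generalized Gaussian density is $$f_p(D,u,x)=A_{n,p}\sqrt{\det D}\left(1+\tfrac{1-p}{2p-n(1-p)}\langle x-u,D(x-u)\rangle\right)^{\frac1{p-1}}$$ for $x\in\mathrm{Dom}(p,D,u)$ and $0$ otherwise. Here $\mathrm{Dom}(p,D,u)=\mathbb R^n$ if $\frac n{n+2}<p<1$, and $\mathrm{Dom}(p,D,u)=\{x\in\mathbb R^n: 1+\frac{1-p}{2p-n(1-p)}\langle x-u,D(x-u)\rangle\ge0\}$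 if $p>1$. The normalization constant is $A_{n,p}=\left(\frac{1-p}{2p-n(1-p)}\right)^{n/2}\frac{\Gamma(\frac1{1-p})}{\pi^{n/2}\Gamma(\frac1{1-p}-\frac n2)}$ if $\frac n{n+2}<p<1$, and $A_{n,p}=\left(\frac{p-1}{2p-n(1-p)}\right)^{n/2}\frac{\Gamma(\frac p{p-1}+\frac n2)}{\pi^{n/2}\Gamma(\frac p{p-1})}$ if $p>1$. For $p=1$, $f_1(D,u,x)=\frac{\sqrt{\det D}}{(2\pi)^{n/2}}\exp\left(-\frac12\langle x-u,D(x-u)\rangle\right)$. *)

theory Defs
  imports "HOL-Analysis.Analysis"
begin

definition sym_mat :: "real^'n^'n \<Rightarrow> bool" where
  "sym_mat A \<longleftrightarrow> transpose A = A"

definition spd :: "(real^'n^'n) set" where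
  "spd = {A. sym_mat A \<and> (\<forall>x. x \<noteq> 0 \<longrightarrow> x \<bullet> (A *v x) > 0)}"

definition gg_base :: "real \<Rightarrow> real^'n^'n \<Rightarrow> real^'n \<Rightarrow> real^'n \<Rightarrow> real" where
  "gg_base p D u x =
     1 + (1 - p) / (2 * p - real CARD('n) * (1 - p)) * ((x - u) \<bullet> (D *v (x - u)))"

definition gg_Dom :: "real \<Rightarrow> real^'n^'n \<Rightarrow> real^'n \<Rightarrow> (real^'n) set" where
  "gg_Dom p D u = (if p < 1 then UNIV else {x. gg_base p D u x \<ge> 0})"

definition gg_const :: "nat \<Rightarrow> real \<Rightarrow> real" where
  "gg_const n p =
     (if p < 1
      then ((1 - p) / (2 * p - real n * (1 - p))) powr (real n / 2)
             * (Gamma (1 / (1 - p))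
                / (pi powr (real n / 2) * Gamma (1 / (1 - p) - real n / 2)))
      else ((p - 1) / (2 * p - real n * (1 - p))) powr (real n / 2)
             * (Gamma (p / (p - 1) + real n / 2)
                / (pi powr (real n / 2) * Gamma (p / (p - 1)))))"

(* Only meaningful for D in spd and p > n / (n + 2). On the boundary of the domain
   for p > 1, 0 powr a = 0 gives the value 0. *)
definition gg_density :: "real \<Rightarrow> real^'n^'n \<Rightarrow> real^'n \<Rightarrow> real^'n \<Rightarrow> real" where
  "gg_density p D u x =
     (if p = 1
      then sqrt (det D) / (2 * pi) powr (real CARD('n) / 2)
             * exp (- (1 / 2) * ((x - u) \<bullet> (D *v (x - u))))
      else if x \<in> gg_Dom p D u
      then gg_const CARD('n) p * sqrt (det D) * gg_base p D u x powr (1 / (p - 1))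
      else 0)"

definition renyi_entropy :: "real \<Rightarrow> (real^'n \<Rightarrow> real) \<Rightarrow> real" where
  "renyi_entropy q f = 1 / (1 - q) * ln (\<integral>x. f x powr q \<partial>lborel)"

definition renyi_gg :: "real \<Rightarrow> real \<Rightarrow> real^'n^'n \<Rightarrow> real" where
  "renyi_gg p q D = renyi_entropy q (gg_density p D 0)"

definition renyi_form :: "real \<Rightarrow> real \<Rightarrow> real^'n^'n \<Rightarrow> real^'n^'n \<Rightarrow> real^'n^'n \<Rightarrow> real" where
  "renyi_form p q D X Y =
     deriv (\<lambda>s. deriv (\<lambda>t. renyi_gg p q (D + t *\<^sub>R X + s *\<^sub>R Y)) 0) 0"

(* The mixed partial derivative in renyi_form exists: the inner one for all s near 0,
   the outer one at s = 0 (deriv by itself is also defined where there is no derivative). *)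
definition renyi_form_exists ::
  "real \<Rightarrow> real \<Rightarrow> real^'n^'n \<Rightarrow> real^'n^'n \<Rightarrow> real^'n^'n \<Rightarrow> bool" where
  "renyi_form_exists p q D X Y \<longleftrightarrow>
     (\<forall>\<^sub>F s in nhds 0. (\<lambda>t. renyi_gg p q (D + t *\<^sub>R X + s *\<^sub>R Y)) differentiable (at 0)) \<and>
     (\<lambda>s. deriv (\<lambda>t. renyi_gg p q (D + t *\<^sub>R X + s *\<^sub>R Y)) 0) differentiable (at 0)"

end

theory Submission
  imports Defs
begin

text \<open>
  On positive definite matrices the entropy is \<open>renyi_gg p q E = K - 1 / 2 * ln (det E)\<close> with a
  constant \<open>K\<close> that depends only on \<open>p\<close>, \<open>q\<close> and the dimension (\<open>renyi_gg_eq_ln_det\<close>).  Indeed the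
  density is \<open>sqrt (det E)\<close> times a fixed function of the quadratic form \<open>\<langle>x, E x\<rangle>\<close>, and a linear
  substitution \<open>x = B y\<close> with \<open>transpose B ** E ** B = mat 1\<close> removes \<open>E\<close> from the integral of its
  \<open>q\<close>-th power at the price of the factor \<open>\<bar>det B\<bar> = 1 / sqrt (det E)\<close>.

  What remains is the Hessian of \<open>- 1 / 2 * ln det\<close>.  Its first derivative in direction \<open>X\<close> is
  \<open>- 1 / 2 * trace (matrix_inv E ** X)\<close> by Jacobi's formula (\<open>has_field_derivative_ln_det\<close>).  In
  direction \<open>Y\<close> the inverse has derivative \<open>- (matrix_inv E ** Y ** matrix_inv E)\<close>
  (\<open>has_field_derivative_trace_matrix_inv\<close>), and the two signs cancel.

  Two analytic points need care.  The linear change of variables is wanted for an arbitrary finite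
  index type (\<open>nn_integral_lborel_linear\<close>).  And the common factor of the integrals must not be
  zero, so that its logarithm splits off as an additive constant; this holds because the density is
  positive near the origin (\<open>gg_profile_pos_near_0\<close>).
\<close>

section \<open>Linear change of variables\<close>

text \<open>Integrate first over the coordinate along \<open>b\<close>, all others being held fixed.  On such a line the
  shear adds a constant, because the coordinate along \<open>b'\<close> is one of those held fixed, and
  one-dimensional Lebesgue measure is invariant under translation.\<close>

lemma nn_integral_lborel_shear:
  fixes f :: "'a::euclidean_space \<Rightarrow> ennreal"
  assumes f [measurable]: "f \<in> borel_measurable borel"
    and b: "b \<in> Basis" "b' \<in> Basis" "b \<noteq> b'"
  shows "(\<integral>\<^sup>+x. f (x + (c * (x \<bullet> b')) *\<^sub>R b) \<partial>lborel) = (\<integral>\<^sup>+x. f x \<partial>lborel)"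
proof -
  interpret product_sigma_finite "\<lambda>_::'a. lborel :: real measure"
    by standard
  define I where "I = (Basis :: 'a set) - {b}"
  have I: "finite I" "b \<notin> I" "insert b I = Basis" "b' \<in> I"
    using b by (auto simp: I_def)
  (* Tonelli with the coordinate along b innermost *)
  have split: "(\<integral>\<^sup>+x. h x \<partial>lborel) =
      (\<integral>\<^sup>+x. (\<integral>\<^sup>+t. h ((\<Sum>k\<in>I. x k *\<^sub>R k) + t *\<^sub>R b) \<partial>lborel) \<partial>(\<Pi>\<^sub>M k\<in>I. lborel))"
    if h [measurable]: "h \<in> borel_measurable borel" for h :: "'a \<Rightarrow> ennreal"
  proof -
    have "(\<integral>\<^sup>+x. h x \<partial>lborel) =
        (\<integral>\<^sup>+x. h (\<Sum>k\<in>Basis. x k *\<^sub>R k) \<partial>(\<Pi>\<^sub>M k\<in>insert b I. lborel))"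
      by (subst lborel_eq) (simp add: nn_integral_distr I)
    also have "\<dots> = (\<integral>\<^sup>+x. (\<integral>\<^sup>+t. h (\<Sum>k\<in>Basis. (x(b := t)) k *\<^sub>R k) \<partial>lborel)
        \<partial>(\<Pi>\<^sub>M k\<in>I. lborel))"
      by (rule product_nn_integral_insert) (use I in \<open>auto simp del: fun_upd_apply\<close>)
    also have "(\<lambda>x t. \<Sum>k\<in>Basis. (x(b := t)) k *\<^sub>R k)
        = (\<lambda>x t. (\<Sum>k\<in>I. x k *\<^sub>R k) + t *\<^sub>R b)"
    proof (intro ext)
      fix x :: "'a \<Rightarrow> real" and t
      have "(\<Sum>k\<in>Basis. (x(b := t)) k *\<^sub>R k) = t *\<^sub>R b + (\<Sum>k\<in>I. (x(b := t)) k *\<^sub>R k)"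
        using I(1,2) unfolding I(3)[symmetric] by simp
      also have "(\<Sum>k\<in>I. (x(b := t)) k *\<^sub>R k) = (\<Sum>k\<in>I. x k *\<^sub>R k)"
        using I(2) by (intro sum.cong) auto
      finally show "(\<Sum>k\<in>Basis. (x(b := t)) k *\<^sub>R k) = (\<Sum>k\<in>I. x k *\<^sub>R k) + t *\<^sub>R b"
        by simp
    qed
    finally show ?thesis by (simp add: fun_eq_iff)
  qed
  have coord: "((\<Sum>k\<in>I. x k *\<^sub>R k) + t *\<^sub>R b) \<bullet> b' = x b'" for x :: "'a \<Rightarrow> real" and t
  proof -
    have "(\<Sum>k\<in>I. x k * (k \<bullet> b')) = (\<Sum>k\<in>I. if k = b' then x k else 0)"
      using b by (intro sum.cong) (auto simp: I_def inner_Basis)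
    then show ?thesis
      using b I(1,4) by (simp add: inner_add_left inner_sum_left inner_Basis)
  qed
  have "(\<integral>\<^sup>+x. f (x + (c * (x \<bullet> b')) *\<^sub>R b) \<partial>lborel) =
      (\<integral>\<^sup>+x. (\<integral>\<^sup>+t. f ((\<Sum>k\<in>I. x k *\<^sub>R k) + (c * x b' + 1 * t) *\<^sub>R b) \<partial>lborel)
        \<partial>(\<Pi>\<^sub>M k\<in>I. lborel))"
    by (subst split) (simp_all only: coord, simp_all add: scaleR_add_left add_ac)
  also have "\<dots> = (\<integral>\<^sup>+x. (\<integral>\<^sup>+t. f ((\<Sum>k\<in>I. x k *\<^sub>R k) + t *\<^sub>R b) \<partial>lborel)
        \<partial>(\<Pi>\<^sub>M k\<in>I. lborel))"
  proof (rule nn_integral_cong)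
    fix x :: "'a \<Rightarrow> real"
    show "(\<integral>\<^sup>+t. f ((\<Sum>k\<in>I. x k *\<^sub>R k) + (c * x b' + 1 * t) *\<^sub>R b) \<partial>lborel)
        = (\<integral>\<^sup>+t. f ((\<Sum>k\<in>I. x k *\<^sub>R k) + t *\<^sub>R b) \<partial>lborel)"
      using nn_integral_real_affine[of "\<lambda>t. f ((\<Sum>k\<in>I. x k *\<^sub>R k) + t *\<^sub>R b)" 1 "c * x b'"]
      by simp
  qed
  also have "\<dots> = (\<integral>\<^sup>+x. f x \<partial>lborel)"
    by (rule split[symmetric]) simp
  finally show ?thesis .
qed

lemma Basis_vec_eq_range_axis: "(Basis :: (real^'n) set) = range (\<lambda>i. axis i 1)"
  by (auto simp: Basis_vec_def)

lemma
  shows sum_Basis_vec: "(\<Sum>b\<in>(Basis :: (real^'n) set). g b) = (\<Sum>i\<in>UNIV. g (axis i 1))"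
    and prod_Basis_vec: "(\<Prod>b\<in>(Basis :: (real^'n) set). h b) = (\<Prod>i\<in>UNIV. h (axis i 1))"
  unfolding Basis_vec_eq_range_axis
  by (simp_all add: sum.reindex prod.reindex inj_on_def axis_eq_axis)

lemma matrix_vector_mult_measurable [measurable]:
  "(\<lambda>x. A *v x) \<in> borel_measurable borel" for A :: "real^'n^'n"
  by (intro borel_measurable_continuous_onI linear_continuous_on matrix_vector_mul_bounded_linear)

text \<open>The formula is multiplicative in \<open>A\<close>, so it suffices to check it for diagonal matrices, for
  transpositions of two coordinates, and for shears; a matrix with a zero row is excluded by
  its determinant.  The index type is an arbitrary finite type: only the individual coordinates
  occur, never an order on them, as would be needed to speak of triangular matrices.\<close>

lemma nn_integral_lborel_linear:
  fixes A :: "real^'n^'n"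
  assumes "det A \<noteq> 0" and "f \<in> borel_measurable borel"
  shows "(\<integral>\<^sup>+x. f x \<partial>lborel) = ennreal \<bar>det A\<bar> * (\<integral>\<^sup>+x. f (A *v x) \<partial>lborel)"
proof -
  define P where "P A \<longleftrightarrow> (det A \<noteq> 0 \<longrightarrow> (\<forall>f\<in>borel_measurable borel.
    (\<integral>\<^sup>+x. f x \<partial>lborel) = ennreal \<bar>det A\<bar> * (\<integral>\<^sup>+x. f (A *v x) \<partial>lborel)))" for A :: "real^'n^'n"
  have "P A"
  proof (rule induct_matrix_elementary)
    fix A B :: "real^'n^'n" assume AB: "P A" "P B"
    show "P (A ** B)"
      unfolding P_def
    proof (intro impI ballI)
      fix f :: "real^'n \<Rightarrow> ennreal" assume f [measurable]: "f \<in> borel_measurable borel"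
      assume "det (A ** B) \<noteq> 0"
      then have "det A \<noteq> 0" and "det B \<noteq> 0" by (auto simp: det_mul)
      have "(\<integral>\<^sup>+x. f x \<partial>lborel) = ennreal \<bar>det A\<bar> * (\<integral>\<^sup>+x. f (A *v x) \<partial>lborel)"
        using AB(1) f \<open>det A \<noteq> 0\<close> unfolding P_def by blast
      also have "(\<integral>\<^sup>+x. f (A *v x) \<partial>lborel)
          = ennreal \<bar>det B\<bar> * (\<integral>\<^sup>+x. f (A *v (B *v x)) \<partial>lborel)"
      proof -
        have "(\<lambda>x. f (A *v x)) \<in> borel_measurable borel" by measurable
        with AB(2) \<open>det B \<noteq> 0\<close> show ?thesis unfolding P_def by blast
      qed
      finally show "(\<integral>\<^sup>+x. f x \<partial>lborel)
          = ennreal \<bar>det (A ** B)\<bar> * (\<integral>\<^sup>+x. f ((A ** B) *v x) \<partial>lborel)"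
        by (simp only: det_mul abs_mult ennreal_mult abs_ge_zero matrix_vector_mul_assoc mult.assoc)
    qed
  next
    fix A :: "real^'n^'n" and i assume "row i A = 0"
    then show "P A" by (simp add: P_def det_zero_row(2))
  next
    fix A :: "real^'n^'n" assume diag: "\<And>i j. i \<noteq> j \<Longrightarrow> A $ i $ j = 0"
    show "P A"
      unfolding P_def
    proof (intro impI ballI)
      fix f :: "real^'n \<Rightarrow> ennreal" assume f [measurable]: "f \<in> borel_measurable borel"
      assume "det A \<noteq> 0"
      then have nz: "A $ i $ i \<noteq> 0" for i
        by (auto simp: det_diagonal[OF diag])
      (* the diagonal of A, indexed by the basis vectors instead of the coordinates *)
      define c where "c j = j \<bullet> (A *v j)" for j :: "real^'n"
      have c: "c (axis i 1) = A $ i $ i" for i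
        by (simp add: c_def matrix_vector_mult_basis column_def inner_axis')
      have T: "0 + (\<Sum>j\<in>Basis. (c j * (x \<bullet> j)) *\<^sub>R j) = A *v x" for x
      proof -
        have "(\<Sum>j\<in>UNIV. A $ i $ j * x $ j) = (\<Sum>j\<in>UNIV. if j = i then A $ i $ i * x $ i else 0)"
          "(\<Sum>j\<in>UNIV. A $ j $ j * x $ j * axis j 1 $ i)
              = (\<Sum>j\<in>UNIV. if j = i then A $ i $ i * x $ i else 0)" for i
          by (intro sum.cong; force simp: diag axis_def)+
        then show ?thesis
          by (simp add: vec_eq_iff sum_Basis_vec c inner_axis matrix_vector_mult_def)
      qed
      have "j \<in> Basis \<Longrightarrow> c j \<noteq> 0" for j
        using nz by (auto simp: Basis_vec_def c)
      from lborel_affine_euclidean[where c = c and t = 0, OF this]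
      have eq: "lborel = density (distr lborel borel (\<lambda>x. A *v x)) (\<lambda>_. ennreal \<bar>det A\<bar>)"
        unfolding T by (simp add: prod_Basis_vec c det_diagonal[OF diag] abs_prod)
      show "(\<integral>\<^sup>+x. f x \<partial>lborel) = ennreal \<bar>det A\<bar> * (\<integral>\<^sup>+x. f (A *v x) \<partial>lborel)"
        by (subst eq) (simp add: nn_integral_density nn_integral_distr nn_integral_cmult)
    qed
  next
    fix m n :: 'n assume "m \<noteq> n"
    let ?t = "Transposition.transpose m n"
    let ?A = "(\<chi> i j. mat 1 $ i $ ?t j) :: real^'n^'n"
    have det: "\<bar>det ?A\<bar> = 1"
      using \<open>m \<noteq> n\<close> det_permute_columns[OF permutes_swap_id[of m UNIV n], of "mat 1 :: real^'n^'n"]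
      by (simp add: sign_swap_id)
    have app: "(?A *v x) $ i = x $ ?t i" for x i
    proof -
      have "i = ?t j \<longleftrightarrow> j = ?t i" for j
        by (metis transpose_involutory)
      then have "(?A *v x) $ i = (\<Sum>j\<in>UNIV. if j = ?t i then x $ j else 0)"
        unfolding matrix_vector_mult_def mat_def vec_lambda_beta
        by (intro sum.cong) simp_all
      then show ?thesis by simp
    qed
    have preserved: "lborel = distr lborel borel (\<lambda>x. ?A *v x)"
    proof (rule lborel_eqI)
      fix l u :: "real^'n" assume le: "\<And>b. b \<in> Basis \<Longrightarrow> l \<bullet> b \<le> u \<bullet> b"
      then have le': "l $ i \<le> u $ i" for i
        using le[of "axis i 1"] by (auto simp: Basis_vec_eq_range_axis inner_axis)
      have le_A: "(?A *v l) \<bullet> b \<le> (?A *v u) \<bullet> b" if "b \<in> Basis" for b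
        using that by (auto simp: Basis_vec_eq_range_axis inner_axis app le')
      have "(\<lambda>x. ?A *v x) -` box l u = box (?A *v l) (?A *v u)"
        by (auto simp: mem_box_cart app) (metis transpose_involutory)+
      then have "emeasure (distr lborel borel (\<lambda>x. ?A *v x)) (box l u)
          = (\<Prod>i\<in>UNIV. (u - l) $ ?t i)"
        by (simp add: emeasure_distr emeasure_lborel_box[OF le_A] prod_Basis_vec inner_axis app)
      also have "(\<Prod>i\<in>UNIV. (u - l) $ ?t i) = (\<Prod>i\<in>UNIV. (u - l) $ i)"
        by (rule prod.permute[OF permutes_swap_id, unfolded o_def, symmetric]) auto
      finally show "emeasure (distr lborel borel (\<lambda>x. ?A *v x)) (box l u)
          = (\<Prod>b\<in>Basis. (u - l) \<bullet> b)"
        by (simp add: prod_Basis_vec inner_axis)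
    qed simp
    have invariant: "(\<integral>\<^sup>+x. f x \<partial>lborel) = (\<integral>\<^sup>+x. f (?A *v x) \<partial>lborel)"
      if f [measurable]: "f \<in> borel_measurable borel" for f
      by (subst preserved) (simp add: nn_integral_distr)
    show "P ?A"
      unfolding P_def det ennreal_1 mult_1 by (intro impI ballI invariant)
  next
    fix m n :: 'n and c :: real assume "m \<noteq> n"
    let ?A = "(\<chi> i j. if i = m \<and> j = n then c else of_bool (i = j)) :: real^'n^'n"
    (* adding c times row n to row m turns the identity into ?A *)
    have "?A = (\<chi> k. if k = m then row m (mat 1) + c *s row n (mat 1) else row k (mat 1))"
      using \<open>m \<noteq> n\<close> by (auto simp: vec_eq_iff row_def mat_def)
    then have det: "det ?A = 1"
      using det_row_operation[OF \<open>m \<noteq> n\<close>, of "mat 1" c] by simp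
    have app: "?A *v x = x + (c * (x \<bullet> axis n 1)) *\<^sub>R axis m 1" for x
    proof -
      have "(?A *v x) $ i = (\<Sum>j\<in>UNIV. (if j = i then x $ j else 0)
          + (if j = n then (if i = m then c * x $ j else 0) else 0))" for i
        unfolding matrix_vector_mult_def vec_lambda_beta using \<open>m \<noteq> n\<close>
        by (intro sum.cong) auto
      then show ?thesis
        by (simp add: vec_eq_iff sum.distrib inner_axis) (simp add: axis_def)
    qed
    show "P ?A"
      using \<open>m \<noteq> n\<close> unfolding P_def det app
      by (simp add: nn_integral_lborel_shear axis_eq_axis)
  qed
  then show ?thesis using assms unfolding P_def by blast
qed

lemma integral_lborel_linear_nonneg:
  fixes A :: "real^'n^'n" and f :: "real^'n \<Rightarrow> real"
  assumes "det A \<noteq> 0" and [measurable]: "f \<in> borel_measurable borel" and "\<And>x. 0 \<le> f x"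
  shows "(\<integral>x. f x \<partial>lborel) = \<bar>det A\<bar> * (\<integral>x. f (A *v x) \<partial>lborel)"
  using assms nn_integral_lborel_linear[OF assms(1), of "\<lambda>x. ennreal (f x)"]
  by (simp add: integral_eq_nn_integral enn2real_mult)


section \<open>Positive definite matrices\<close>

lemma matrix_inv_inverse:
  fixes A :: "real^'n^'n"
  assumes "det A \<noteq> 0"
  shows "A ** matrix_inv A = mat 1" "matrix_inv A ** A = mat 1"
proof -
  from assms have "\<exists>B. A ** B = mat 1 \<and> B ** A = mat 1"
    by (metis invertible_det_nz invertible_def)
  from someI_ex[OF this] show "A ** matrix_inv A = mat 1" "matrix_inv A ** A = mat 1"
    by (simp_all add: matrix_inv_def)
qed

lemma sym_mat_inner:
  "sym_mat A \<Longrightarrow> x \<bullet> (A *v y) = y \<bullet> (A *v x)"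
  using dot_lmul_matrix[of x A y] transpose_matrix_vector[of A x]
  by (simp add: sym_mat_def inner_commute)

text \<open>Gram-Schmidt for the inner product \<open>\<langle>x, E y\<rangle>\<close>.  As long as fewer than \<open>n\<close> vectors have been
  chosen, their images under \<open>E\<close> do not span the space, so some nonzero vector is orthogonal, in
  the ordinary sense, to all these images; normalizing it extends the system.\<close>

lemma spd_orthonormal_system:
  fixes E :: "real^'n^'n" and S :: "'n set"
  assumes E: "E \<in> spd"
  shows "\<exists>v :: 'n \<Rightarrow> real^'n. \<forall>i\<in>S. \<forall>j\<in>S. v i \<bullet> (E *v v j) = (if i = j then 1 else 0)"
proof -
  have "finite S" by simp
  then show ?thesis
  proof (induction S rule: finite_induct)
    case (insert k S)
    then obtain v :: "'n \<Rightarrow> real^'n"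
      where v: "\<And>i j. i \<in> S \<Longrightarrow> j \<in> S \<Longrightarrow> v i \<bullet> (E *v v j) = (if i = j then 1 else 0)"
      by blast
    let ?W = "(\<lambda>j. E *v v j) ` S"
    have "dim ?W \<le> card S"
      using insert.hyps by (meson card_image_le dim_le_card' finite_imageI le_trans)
    also have "card S < CARD('n)"
      using insert.hyps by (metis card_seteq finite_class.finite_UNIV not_le subset_UNIV UNIV_I)
    finally have "dim ?W < DIM(real^'n)" by simp
    then obtain w where w: "w \<noteq> 0" "\<And>y. y \<in> span ?W \<Longrightarrow> orthogonal w y"
      using orthogonal_to_subspace_exists by blast
    have orth: "w \<bullet> (E *v v j) = 0" if "j \<in> S" for j
      using w(2)[of "E *v v j"] that by (simp add: orthogonal_def span_base)
    have pos: "w \<bullet> (E *v w) > 0" and sym: "sym_mat E"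
      using E w(1) by (auto simp: spd_def)
    define u where "u = (1 / sqrt (w \<bullet> (E *v w))) *\<^sub>R w"
    have u: "u \<bullet> (E *v u) = 1"
      using pos by (simp add: u_def matrix_vector_mult_scaleR)
    have uv: "u \<bullet> (E *v v j) = 0" "v j \<bullet> (E *v u) = 0" if "j \<in> S" for j
      using orth[OF that] sym_mat_inner[OF sym, of "v j" u] by (auto simp: u_def)
    show ?case
      using insert.hyps(2) by (intro exI[of _ "v(k := u)"]) (auto simp: v u uv)
  qed auto
qed

text \<open>The columns of \<open>B\<close> are an orthonormal basis for the inner product \<open>\<langle>x, E y\<rangle>\<close>.  The substitution
  \<open>x = B y\<close> therefore turns the quadratic form of \<open>E\<close> into \<open>\<langle>y, y\<rangle>\<close>, which replaces a
  diagonalization of \<open>E\<close>.\<close>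

lemma spd_congruent_mat_1:
  fixes E :: "real^'n^'n"
  assumes "E \<in> spd"
  shows "\<exists>B :: real^'n^'n. transpose B ** E ** B = mat 1"
proof -
  obtain v :: "'n \<Rightarrow> real^'n" where v: "\<And>i j. v i \<bullet> (E *v v j) = (if i = j then 1 else 0)"
    using spd_orthonormal_system[OF assms, of UNIV] by auto
  define B :: "real^'n^'n" where "B = (\<chi> i j. v j $ i)"
  have col: "B *v axis j 1 = v j" for j
    by (simp add: matrix_vector_mult_basis column_def B_def)
  have "(transpose B ** E ** B) $ i $ j = (mat 1 :: real^'n^'n) $ i $ j" for i j
  proof -
    have "(transpose B ** E ** B) $ i $ j = axis i 1 \<bullet> ((transpose B ** E ** B) *v axis j 1)"
      by (simp add: matrix_vector_mult_basis column_def inner_axis')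
    also have "\<dots> = (B *v axis i 1) \<bullet> (E *v (B *v axis j 1))"
      by (metis dot_lmul_matrix inner_commute matrix_vector_mul_assoc transpose_matrix_vector)
    finally show ?thesis by (simp add: col v mat_def)
  qed
  then show ?thesis by (intro exI[of _ B]) (simp add: vec_eq_iff)
qed

lemma spd_det_pos:
  fixes E :: "real^'n^'n"
  assumes "E \<in> spd"
  shows "0 < det E"
proof -
  obtain B :: "real^'n^'n" where "transpose B ** E ** B = mat 1"
    using spd_congruent_mat_1[OF assms] by blast
  from arg_cong[OF this, of det] have "det B * det E * det B = 1"
    by (simp add: det_mul)
  then have "det E * (det B)\<^sup>2 = 1" by (simp add: power2_eq_square mult_ac)
  then show "0 < det E"
    using mult_nonpos_nonneg[of "det E" "(det B)\<^sup>2"] by (cases "det E \<le> 0") auto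
qed

lemma mat_1_spd: "mat 1 \<in> (spd :: (real^'n^'n) set)"
  by (simp add: spd_def sym_mat_def transpose_mat)

text \<open>The form of \<open>E\<close> is bounded below by \<open>c \<parallel>x\<parallel>\<^sup>2\<close>, where \<open>c > 0\<close> is its minimum on the unit sphere,
  and the form of \<open>Z\<close> is bounded in absolute value by \<open>K \<parallel>x\<parallel>\<^sup>2\<close>.  So the sum stays positive
  definite while \<open>\<bar>t\<bar> < c / K\<close>.\<close>

lemma spd_add_eventually:
  fixes E Z :: "real^'n^'n"
  assumes E: "E \<in> spd" and Z: "sym_mat Z"
  shows "\<forall>\<^sub>F t in nhds 0. E + t *\<^sub>R Z \<in> spd"
proof -
  let ?S = "sphere (0 :: real^'n) 1"
  have "continuous_on ?S (\<lambda>x. x \<bullet> (E *v x))"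
    by (intro continuous_intros linear_continuous_on matrix_vector_mul_bounded_linear)
  moreover have "?S \<noteq> {}" by simp
  ultimately obtain x0 where x0: "x0 \<in> ?S" "\<And>x. x \<in> ?S \<Longrightarrow> x0 \<bullet> (E *v x0) \<le> x \<bullet> (E *v x)"
    using continuous_attains_inf[OF compact_sphere, of 0 1] by blast
  define c where "c = x0 \<bullet> (E *v x0)"
  have "x0 \<noteq> 0" using x0(1) by auto
  then have "c > 0" using E by (simp add: c_def spd_def)
  have lower: "c * (norm x)\<^sup>2 \<le> x \<bullet> (E *v x)" for x
  proof (cases "x = 0")
    case False
    then have "c \<le> (x /\<^sub>R norm x) \<bullet> (E *v (x /\<^sub>R norm x))"
      unfolding c_def by (intro x0(2)) simp
    then show ?thesis
      using False by (simp add: matrix_vector_mult_scaleR field_simps power2_eq_square)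
  qed auto
  obtain K where K: "K > 0" "\<And>x. norm (Z *v x) \<le> norm x * K"
    using bounded_linear.pos_bounded[OF matrix_vector_mul_bounded_linear[of Z]] by blast
  have "E + t *\<^sub>R Z \<in> spd" if t: "\<bar>t\<bar> < c / K" for t
  proof -
    have "x \<bullet> ((E + t *\<^sub>R Z) *v x) > 0" if "x \<noteq> 0" for x
    proof -
      have "\<bar>x \<bullet> (Z *v x)\<bar> \<le> norm x * (norm x * K)"
        by (meson Cauchy_Schwarz_ineq2 K(2) mult_left_mono norm_ge_zero order_trans)
      then have "\<bar>t\<bar> * \<bar>x \<bullet> (Z *v x)\<bar> \<le> \<bar>t\<bar> * (norm x * (norm x * K))"
        by (rule mult_left_mono) simp
      then have "\<bar>t * (x \<bullet> (Z *v x))\<bar> \<le> (\<bar>t\<bar> * K) * (norm x)\<^sup>2"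
        by (simp add: abs_mult power2_eq_square mult_ac)
      also have "\<dots> < c * (norm x)\<^sup>2"
        using t K(1) that by (simp add: field_simps)
      also note lower[of x]
      finally show ?thesis
        by (simp add: matrix_vector_mult_add_rdistrib inner_add_right flip: scaleR_matrix_vector_assoc)
    qed
    moreover have "transpose (E + t *\<^sub>R Z) = E + t *\<^sub>R Z"
      using E Z by (simp add: spd_def sym_mat_def transpose_def vec_eq_iff)
    ultimately show ?thesis by (simp add: spd_def sym_mat_def)
  qed
  moreover have "c / K > 0" using \<open>c > 0\<close> K(1) by simp
  ultimately show ?thesis
    unfolding eventually_nhds_metric by (intro exI[of _ "c / K"]) (simp add: dist_real_def)
qed


section \<open>Derivatives of the determinant and of the inverse\<close>

text \<open>Differentiate the Leibniz expansion.  A permutation other than the identity moves at least two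
  indices, so after one factor has been differentiated there is still an off-diagonal entry of the
  identity matrix left, and the term vanishes at \<open>0\<close>.\<close>

lemma has_field_derivative_det_mat_1:
  fixes X :: "real^'n^'n"
  shows "((\<lambda>t. det (mat 1 + t *\<^sub>R X)) has_field_derivative trace X) (at 0)"
proof -
  let ?P = "{p. p permutes (UNIV :: 'n set)}"
  let ?M = "mat 1 :: real^'n^'n"
  let ?d = "\<lambda>p. of_int (sign p) * (\<Sum>i\<in>UNIV. X $ i $ p i * (\<Prod>j\<in>UNIV - {i}. (?M + 0 *\<^sub>R X) $ j $ p j))"
  have 1: "((\<lambda>t. det (?M + t *\<^sub>R X)) has_field_derivative (\<Sum>p\<in>?P. ?d p)) (at 0)"
    unfolding det_def
    by (intro DERIV_sum DERIV_cmult has_field_derivative_prod) (auto intro!: derivative_eq_intros)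
  have "?d p = (if p = id then trace X else 0)" if p: "p \<in> ?P" for p
  proof (cases "p = id")
    case True
    then show ?thesis by (simp add: trace_def mat_def)
  next
    case False
    have "(\<Prod>j\<in>UNIV - {i}. (?M + 0 *\<^sub>R X) $ j $ p j) = 0" for i
    proof -
      have "\<exists>j. j \<noteq> i \<and> p j \<noteq> j"
      proof (rule ccontr)
        assume "\<nexists>j. j \<noteq> i \<and> p j \<noteq> j"
        then have "p j = j" if "j \<noteq> i" for j using that by blast
        moreover from this have "p i = i"
          using p by (metis mem_Collect_eq permutes_inj injD)
        ultimately have "p = id" by (metis eq_id_iff)
        with False show False ..
      qed
      then obtain j where "j \<noteq> i" "p j \<noteq> j" by blast
      then show ?thesis by (intro prod_zero) (auto simp: mat_def intro!: bexI[of _ j])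
    qed
    then show ?thesis using False by (simp only: mult_zero_right sum.neutral_const if_False)
  qed
  then have "(\<Sum>p\<in>?P. ?d p) = (\<Sum>p\<in>?P. if p = id then trace X else 0)"
    by (rule sum.cong[OF refl])
  also have "\<dots> = trace X"
    by (simp add: permutes_id finite_permutations)
  finally show ?thesis using 1 by simp
qed

text \<open>Reduce to the identity matrix by \<open>E + t X = E (1 + t inv E X)\<close>.\<close>

lemma has_field_derivative_ln_det:
  fixes E X :: "real^'n^'n"
  assumes "0 < det E"
  shows "((\<lambda>t. ln (det (E + t *\<^sub>R X))) has_field_derivative trace (matrix_inv E ** X)) (at 0)"
proof -
  have "E + t *\<^sub>R X = E ** (mat 1 + t *\<^sub>R (matrix_inv E ** X))" for t
    using matrix_inv_inverse(1)[of E] assms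
    by (simp add: matrix_add_ldistrib matrix_scalar_ac matrix_mul_assoc flip: scalar_matrix_assoc)
  then have "det (E + t *\<^sub>R X) = det E * det (mat 1 + t *\<^sub>R (matrix_inv E ** X))" for t
    by (simp add: det_mul)
  moreover have "((\<lambda>t. det E * det (mat 1 + t *\<^sub>R (matrix_inv E ** X)))
      has_field_derivative det E * trace (matrix_inv E ** X)) (at 0)"
    by (intro DERIV_cmult has_field_derivative_det_mat_1)
  ultimately have "((\<lambda>t. det (E + t *\<^sub>R X)) has_field_derivative
      det E * trace (matrix_inv E ** X)) (at 0)"
    by simp
  from DERIV_chain2[OF DERIV_ln this] show ?thesis
    using assms by (simp add: mult.assoc[symmetric])
qed

lemma tendsto_det:
  fixes N :: "'a \<Rightarrow> real^'n^'n"
  assumes "(N \<longlongrightarrow> L) F"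
  shows "((\<lambda>s. det (N s)) \<longlongrightarrow> det L) F"
  unfolding det_def by (intro tendsto_sum tendsto_mult tendsto_const tendsto_prod tendsto_vec_nth assms)

text \<open>By Cramer's rule the entries of the inverse are quotients of determinants, hence continuous.\<close>

lemma tendsto_matrix_inv:
  fixes N :: "'a \<Rightarrow> real^'n^'n"
  assumes N: "(N \<longlongrightarrow> L) F" and L: "det L \<noteq> 0"
  shows "((\<lambda>s. matrix_inv (N s)) \<longlongrightarrow> matrix_inv L) F"
proof (intro vec_tendstoI)
  fix k l :: 'n
  let ?C = "\<lambda>M :: real^'n^'n. (\<chi> i j. if j = k then axis l 1 $ i else M $ i $ j) :: real^'n^'n"
  have cramer: "det (?C M) / det M = matrix_inv M $ k $ l" if "det M \<noteq> 0" for M :: "real^'n^'n"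
  proof -
    have "M *v (matrix_inv M *v axis l 1) = axis l 1"
      by (simp add: matrix_vector_mul_assoc matrix_inv_inverse(1)[OF that])
    then have "(matrix_inv M *v axis l 1) $ k = det (?C M) / det M"
      unfolding cramer[OF that] by simp
    then show ?thesis by (simp add: matrix_vector_mult_basis column_def)
  qed
  have "((\<lambda>s. ?C (N s)) \<longlongrightarrow> ?C L) F"
  proof (intro vec_tendstoI)
    fix i j
    show "((\<lambda>s. ?C (N s) $ i $ j) \<longlongrightarrow> ?C L $ i $ j) F"
      using N by (cases "j = k") (simp_all add: tendsto_vec_nth)
  qed
  then have "((\<lambda>s. det (?C (N s)) / det (N s)) \<longlongrightarrow> det (?C L) / det L) F"
    using N L by (intro tendsto_divide tendsto_det)
  moreover have "\<forall>\<^sub>F s in F. det (N s) \<noteq> 0"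
    using tendsto_det[OF N] L by (rule tendsto_imp_eventually_ne)
  ultimately show "((\<lambda>s. matrix_inv (N s) $ k $ l) \<longlongrightarrow> matrix_inv L $ k $ l) F"
    unfolding cramer[OF L] by (elim Lim_transform_eventually eventually_mono) (rule cramer)
qed

lemma matrix_add_rdistrib: "(A + B) ** C = A ** C + B ** C"
  for A B :: "real^'n^'m" and C :: "real^'k^'n"
  by (simp add: matrix_matrix_mult_def vec_eq_iff distrib_right sum.distrib)

text \<open>With \<open>N = D + s Y\<close>, the resolvent identity \<open>inv D = inv N + s (inv N) Y (inv D)\<close> gives the
  difference quotient in closed form, as \<open>- trace (inv N Y (inv D) X)\<close>.  Continuity of the inverse
  then yields the limit.\<close>

lemma has_field_derivative_trace_matrix_inv:
  fixes D X Y :: "real^'n^'n"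
  assumes D: "det D \<noteq> 0"
  shows "((\<lambda>s. trace (matrix_inv (D + s *\<^sub>R Y) ** X)) has_field_derivative
           - trace (matrix_inv D ** X ** matrix_inv D ** Y)) (at 0)"
proof -
  let ?N = "\<lambda>s. D + s *\<^sub>R Y"
  let ?C = "Y ** matrix_inv D ** X"
  have N: "(?N \<longlongrightarrow> D) (at 0)"
    by (auto intro!: tendsto_eq_intros)
  have "((\<lambda>s. - trace (matrix_inv (?N s) ** ?C)) \<longlongrightarrow> - trace (matrix_inv D ** ?C)) (at 0)"
    unfolding trace_def matrix_matrix_mult_def
    using tendsto_matrix_inv[OF N D] by (auto intro!: tendsto_intros tendsto_vec_nth)
  moreover have "\<forall>\<^sub>F s in at 0. - trace (matrix_inv (?N s) ** ?C)
      = (trace (matrix_inv (?N s) ** X) - trace (matrix_inv (?N 0) ** X)) / (s - 0)"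
  proof -
    have "\<forall>\<^sub>F s in at 0. det (?N s) \<noteq> 0"
      using tendsto_det[OF N] D by (rule tendsto_imp_eventually_ne)
    moreover have "\<forall>\<^sub>F s in at 0. s \<noteq> (0::real)"
      by (simp add: eventually_at_filter)
    ultimately show ?thesis
    proof eventually_elim
      fix s :: real assume s: "det (?N s) \<noteq> 0" "s \<noteq> 0"
      have "matrix_inv D = matrix_inv (?N s) ** ?N s ** matrix_inv D"
        using matrix_inv_inverse[OF s(1)] by simp
      also have "\<dots> = matrix_inv (?N s) + s *\<^sub>R (matrix_inv (?N s) ** Y ** matrix_inv D)"
        using matrix_inv_inverse[OF D]
        by (simp add: matrix_add_ldistrib matrix_add_rdistrib matrix_scalar_ac
            flip: matrix_mul_assoc scalar_matrix_assoc)
      finally have "matrix_inv D ** X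
          = matrix_inv (?N s) ** X + s *\<^sub>R (matrix_inv (?N s) ** ?C)"
        by (metis matrix_add_rdistrib matrix_mul_assoc scalar_matrix_assoc)
      then have "trace (matrix_inv D ** X)
          = trace (matrix_inv (?N s) ** X) + s * trace (matrix_inv (?N s) ** ?C)"
        by (simp add: trace_add) (simp add: trace_def sum_distrib_left)
      then show "- trace (matrix_inv (?N s) ** ?C)
          = (trace (matrix_inv (?N s) ** X) - trace (matrix_inv (?N 0) ** X)) / (s - 0)"
        using s(2) by (simp add: field_simps)
    qed
  qed
  ultimately have "((\<lambda>s. trace (matrix_inv (?N s) ** X)) has_field_derivative
      - trace (matrix_inv D ** ?C)) (at 0)"
    unfolding has_field_derivative_iff by (rule Lim_transform_eventually)
  moreover have "trace (matrix_inv D ** ?C) = trace (matrix_inv D ** X ** matrix_inv D ** Y)"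
    using trace_mul_sym[of "matrix_inv D ** Y" "matrix_inv D ** X"] by (simp add: matrix_mul_assoc)
  ultimately show ?thesis by simp
qed


section \<open>The entropy of generalized Gaussian densities\<close>

text \<open>The radial shape of the density: the density depends on \<open>x\<close> and \<open>E\<close> only through \<open>det E\<close> and the
  value \<open>r\<close> of the quadratic form.\<close>

definition gg_profile :: "nat \<Rightarrow> real \<Rightarrow> real \<Rightarrow> real" where
  "gg_profile n p r =
     (if p = 1 then 1 / (2 * pi) powr (real n / 2) * exp (- (1 / 2) * r)
      else if p < 1 \<or> 1 + (1 - p) / (2 * p - real n * (1 - p)) * r \<ge> 0
      then gg_const n p * (1 + (1 - p) / (2 * p - real n * (1 - p)) * r) powr (1 / (p - 1))
      else 0)"

lemma gg_density_eq_profile: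
  fixes E :: "real^'n^'n"
  shows "gg_density p E 0 x = sqrt (det E) * gg_profile CARD('n) p (x \<bullet> (E *v x))"
  by (auto simp: gg_density_def gg_profile_def gg_Dom_def gg_base_def)

lemma gg_profile_measurable [measurable]: "gg_profile n p \<in> borel_measurable borel"
  unfolding gg_profile_def[abs_def] by measurable

text \<open>The bound on \<open>p\<close> says that \<open>2 p - n (1 - p)\<close> is positive.  For \<open>p < 1\<close> this is more than enough for
  the argument \<open>1 / (1 - p) - n / 2\<close> of the second Gamma factor to be positive.\<close>

lemma gg_const_pos:
  assumes p: "real n / (real n + 2) < p" "p \<noteq> 1"
  shows "0 < gg_const n p"
proof -
  have d: "0 < 2 * p - real n * (1 - p)"
    using p(1) by (simp add: field_simps)
  show ?thesis
  proof (cases "p < 1")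
    case True
    have "real n / 2 < 1 / (1 - p)"
      using d True by (simp add: field_simps)
    moreover have "0 < 1 / (1 - p)"
      using True by simp
    ultimately show ?thesis
      using d True by (auto simp: gg_const_def intro!: mult_pos_pos divide_pos_pos Gamma_real_pos)
  next
    case False
    then show ?thesis
      using d p(2) by (auto simp: gg_const_def intro!: mult_pos_pos divide_pos_pos Gamma_real_pos add_pos_nonneg)
  qed
qed

lemma gg_profile_nonneg:
  assumes p: "real n / (real n + 2) < p"
  shows "0 \<le> gg_profile n p r"
  using gg_const_pos[OF p] by (auto simp: gg_profile_def)

text \<open>For \<open>p > 1\<close> the density has bounded support, so positivity can only be asked for near the centre.
  The positivity is needed because \<^term>\<open>ln 0 = (0 :: real)\<close>: were the integral of the \<open>q\<close>-th power
  zero, the entropy would not see the determinant at all.\<close>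

lemma gg_profile_pos_near_0:
  assumes p: "real n / (real n + 2) < p"
  obtains \<delta> where "0 < \<delta>" "\<And>r. 0 \<le> r \<Longrightarrow> r < \<delta> \<Longrightarrow> 0 < gg_profile n p r"
proof -
  define \<kappa> where "\<kappa> = (1 - p) / (2 * p - real n * (1 - p))"
  (* adding 1 to the absolute value also covers p = 1, where \<kappa> = 0 *)
  have "0 < gg_profile n p r" if r: "0 \<le> r" "r < 1 / (\<bar>\<kappa>\<bar> + 1)" for r
  proof -
    have "\<bar>\<kappa> * r\<bar> \<le> (\<bar>\<kappa>\<bar> + 1) * r"
      using r(1) by (simp add: abs_mult mult_right_mono)
    also have "\<dots> < 1"
      using r(2) by (simp add: field_simps)
    finally have "0 < 1 + \<kappa> * r" by linarith
    then show ?thesis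
      using gg_const_pos[OF p] unfolding gg_profile_def \<kappa>_def[symmetric] by auto
  qed
  then show ?thesis
    by (intro that[of "1 / (\<bar>\<kappa>\<bar> + 1)"]) auto
qed

text \<open>Substitute \<open>x = B y\<close> with \<open>B\<close> as in \<open>spd_congruent_mat_1\<close>; taking determinants in the congruence
  shows that \<open>\<bar>det B\<bar> = 1 / sqrt (det E)\<close>.\<close>

lemma integral_quadratic_form:
  fixes E :: "real^'n^'n" and \<psi> :: "real \<Rightarrow> real"
  assumes E: "E \<in> spd" and \<psi> [measurable]: "\<psi> \<in> borel_measurable borel" and nonneg: "\<And>r. 0 \<le> \<psi> r"
  shows "(\<integral>x. \<psi> (x \<bullet> (E *v x)) \<partial>lborel) = (\<integral>x. \<psi> (x \<bullet> (x :: real^'n)) \<partial>lborel) / sqrt (det E)"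
proof -
  obtain B :: "real^'n^'n" where B: "transpose B ** E ** B = mat 1"
    using spd_congruent_mat_1[OF E] by blast
  from arg_cong[OF this, of det] have det: "det E * (det B)\<^sup>2 = 1"
    by (simp add: det_mul power2_eq_square mult_ac)
  then have "det B \<noteq> 0" by auto
  have "\<bar>det B\<bar> * sqrt (det E) = 1"
    using arg_cong[OF det, of sqrt] by (simp add: real_sqrt_mult mult.commute)
  then have scale: "\<bar>det B\<bar> = 1 / sqrt (det E)"
    by (metis nonzero_eq_divide_eq mult_zero_right zero_neq_one)
  have form: "(B *v x) \<bullet> (E *v (B *v x)) = x \<bullet> x" for x
  proof -
    have "x \<bullet> x = x \<bullet> ((transpose B ** E ** B) *v x)"
      by (simp add: B)
    also have "\<dots> = x \<bullet> (transpose B *v (E *v (B *v x)))"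
      by (simp only: matrix_vector_mul_assoc matrix_mul_assoc)
    also have "\<dots> = (B *v x) \<bullet> (E *v (B *v x))"
      by (metis dot_lmul_matrix inner_commute transpose_matrix_vector)
    finally show ?thesis ..
  qed
  have "(\<integral>x. \<psi> (x \<bullet> (E *v x)) \<partial>lborel) = \<bar>det B\<bar> * (\<integral>x. \<psi> ((B *v x) \<bullet> (E *v (B *v x))) \<partial>lborel)"
    using \<open>det B \<noteq> 0\<close> nonneg by (intro integral_lborel_linear_nonneg) measurable
  then show ?thesis
    by (simp add: form scale)
qed

text \<open>A nonnegative function with integral zero vanishes almost everywhere, but a ball is not a null set.\<close>

lemma integral_pos_if_pos_on_ball:
  fixes f :: "'a::euclidean_space \<Rightarrow> real"
  assumes f: "integrable lborel f" "\<And>x. 0 \<le> f x"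
    and "0 < e" and pos: "\<And>x. x \<in> ball a e \<Longrightarrow> 0 < f x"
  shows "0 < (\<integral>x. f x \<partial>lborel)"
proof -
  have "(\<integral>x. f x \<partial>lborel) \<noteq> 0"
  proof
    assume "(\<integral>x. f x \<partial>lborel) = 0"
    then have "AE x in lborel. f x = 0"
      using f by (simp add: integral_nonneg_eq_0_iff_AE)
    then have "AE x in lborel. x \<notin> ball a e"
      by eventually_elim (use pos in force)
    then have "emeasure lborel (ball a e) = 0"
      by (subst (asm) AE_iff_null_sets[symmetric]) auto
    then have "ball a e \<in> null_sets lebesgue"
      by (simp add: null_sets_def)
    then show False
      using open_not_negligible[of "ball a e"] \<open>0 < e\<close> by (auto simp: negligible_iff_null_sets)
  qed
  moreover have "0 \<le> (\<integral>x. f x \<partial>lborel)"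
    using f(2) by simp
  ultimately show ?thesis by simp
qed

text \<open>The \<open>q\<close>-th power of the density contributes \<open>(det E) powr (q / 2)\<close> through its normalization, and
  the substitution contributes \<open>(det E) powr (- 1 / 2)\<close>.  The resulting exponent \<open>(q - 1) / 2\<close> is
  cancelled up to sign by the factor \<open>1 / (1 - q)\<close> of the entropy, so neither \<open>p\<close> nor \<open>q\<close> affects
  the dependence on \<open>E\<close>.\<close>

lemma renyi_gg_eq_ln_det:
  fixes p q :: real
  assumes p: "real CARD('n) / (real CARD('n) + 2) < p" and q: "q \<noteq> 1"
    and int: "integrable lborel (\<lambda>x :: real^'n. gg_density p (mat 1) 0 x powr q)"
  obtains K where "\<And>E :: real^'n^'n. E \<in> spd \<Longrightarrow> renyi_gg p q E = K - 1 / 2 * ln (det E)"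
proof -
  define \<psi> where "\<psi> r = gg_profile CARD('n) p r powr q" for r
  (* the part of the integral that is common to all E *)
  define J where "J = (\<integral>x. \<psi> (x \<bullet> (x :: real^'n)) \<partial>lborel)"
  have [measurable]: "\<psi> \<in> borel_measurable borel"
    unfolding \<psi>_def[abs_def] by measurable
  have "0 < J"
    unfolding J_def
  proof -
    obtain \<delta> where \<delta>: "0 < \<delta>" "\<And>r. 0 \<le> r \<Longrightarrow> r < \<delta> \<Longrightarrow> 0 < gg_profile CARD('n) p r"
      using gg_profile_pos_near_0[OF p] by blast
    show "0 < (\<integral>x. \<psi> (x \<bullet> (x :: real^'n)) \<partial>lborel)"
    proof (rule integral_pos_if_pos_on_ball)
      show "integrable lborel (\<lambda>x :: real^'n. \<psi> (x \<bullet> x))"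
        using int by (simp add: gg_density_eq_profile \<psi>_def)
      show "0 < sqrt \<delta>" using \<delta>(1) by simp
      fix x :: "real^'n" assume "x \<in> ball 0 (sqrt \<delta>)"
      then have "norm x < sqrt \<delta>" by simp
      then have "(norm x)\<^sup>2 < (sqrt \<delta>)\<^sup>2"
        by (intro power_strict_mono) auto
      then have "x \<bullet> x < \<delta>"
        using \<delta>(1) by (simp add: power2_norm_eq_inner)
      then show "0 < \<psi> (x \<bullet> x)"
        using \<delta>(2)[of "x \<bullet> x"] by (simp add: \<psi>_def)
    qed (simp add: \<psi>_def)
  qed
  have "renyi_gg p q E = 1 / (1 - q) * ln J - 1 / 2 * ln (det E)" if E: "E \<in> spd" for E :: "real^'n^'n"
  proof -
    have d: "0 < det E" using E by (rule spd_det_pos)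
    have "(\<integral>x. gg_density p E 0 x powr q \<partial>lborel) = sqrt (det E) powr q * (\<integral>x. \<psi> (x \<bullet> (E *v x)) \<partial>lborel)"
      by (simp add: gg_density_eq_profile \<psi>_def powr_mult gg_profile_nonneg[OF p])
    also have "\<dots> = sqrt (det E) powr q * (J / sqrt (det E))"
      using integral_quadratic_form[OF E, of \<psi>] by (simp add: J_def \<psi>_def)
    finally have "ln (\<integral>x. gg_density p E 0 x powr q \<partial>lborel)
        = ln (sqrt (det E) powr q * (J / sqrt (det E)))" by simp
    also have "\<dots> = ln J - (1 - q) * (1 / 2 * ln (det E))"
      using d \<open>0 < J\<close> by (simp add: ln_mult ln_div ln_powr ln_sqrt) (simp add: field_simps)
    finally have ln_integral: "ln (\<integral>x. gg_density p E 0 x powr q \<partial>lborel)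
        = ln J - (1 - q) * (1 / 2 * ln (det E))" .
    show ?thesis
      unfolding renyi_gg_def renyi_entropy_def ln_integral
      using q by (simp add: right_diff_distrib)
  qed
  then show ?thesis by (rule that)
qed


section \<open>The quadratic form\<close>

theorem theorem3p2:
  fixes p q :: real and D X Y :: "real^'n^'n"
  assumes "p > real CARD('n) / (real CARD('n) + 2)"
    and "q > 0" and "q \<noteq> 1"
    and "\<forall>E \<in> (spd :: (real^'n^'n) set). integrable lborel (\<lambda>x. gg_density p E 0 x powr q)"
    and "D \<in> spd" and "sym_mat X" and "sym_mat Y"
  shows "renyi_form_exists p q D X Y \<and>
         renyi_form p q D X Y = 1 / 2 * trace (matrix_inv D ** X ** matrix_inv D ** Y)"
proof -
  obtain K where K: "\<And>E :: real^'n^'n. E \<in> spd \<Longrightarrow> renyi_gg p q E = K - 1 / 2 * ln (det E)"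
    using renyi_gg_eq_ln_det[OF assms(1,3)] assms(4) mat_1_spd by blast
  let ?f = "\<lambda>s t. renyi_gg p q (D + t *\<^sub>R X + s *\<^sub>R Y)"
  let ?g = "\<lambda>s. - (1 / 2) * trace (matrix_inv (D + s *\<^sub>R Y) ** X)"
  (* positive definiteness is open among symmetric matrices, so the formula in terms of
     ln det holds for all parameters near 0 and may be differentiated there *)
  have inner: "(?f s has_field_derivative ?g s) (at 0)" if s: "D + s *\<^sub>R Y \<in> spd" for s
  proof -
    let ?E = "D + s *\<^sub>R Y"
    have "((\<lambda>t. K - 1 / 2 * ln (det (?E + t *\<^sub>R X))) has_field_derivative
        0 - 1 / 2 * trace (matrix_inv ?E ** X)) (at 0)"
      by (intro DERIV_diff DERIV_const DERIV_cmult has_field_derivative_ln_det spd_det_pos s)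
    moreover have "\<forall>\<^sub>F t in nhds 0. ?f s t = K - 1 / 2 * ln (det (?E + t *\<^sub>R X))"
      using spd_add_eventually[OF s assms(6)]
    proof eventually_elim
      fix t assume "?E + t *\<^sub>R X \<in> spd"
      from K[OF this] show "?f s t = K - 1 / 2 * ln (det (?E + t *\<^sub>R X))"
        by (simp add: add_ac)
    qed
    ultimately show ?thesis
      by (simp add: DERIV_cong_ev)
  qed
  have near: "\<forall>\<^sub>F s in nhds 0. D + s *\<^sub>R Y \<in> spd"
    by (rule spd_add_eventually[OF assms(5,7)])
  have "det D \<noteq> 0"
    using spd_det_pos[OF assms(5)] by simp
  then have "(?g has_field_derivative
      - (1 / 2) * - trace (matrix_inv D ** X ** matrix_inv D ** Y)) (at 0)"
    by (intro DERIV_cmult has_field_derivative_trace_matrix_inv)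
  moreover have "\<forall>\<^sub>F s in nhds 0. deriv (?f s) 0 = ?g s"
    using near by eventually_elim (rule DERIV_imp_deriv[OF inner])
  ultimately have outer: "((\<lambda>s. deriv (?f s) 0) has_field_derivative
      1 / 2 * trace (matrix_inv D ** X ** matrix_inv D ** Y)) (at 0)"
    by (subst DERIV_cong_ev) simp_all
  have "renyi_form_exists p q D X Y"
    unfolding renyi_form_exists_def
  proof
    show "\<forall>\<^sub>F s in nhds 0. ?f s differentiable (at 0)"
      using near by eventually_elim (use inner real_differentiable_def in blast)
    show "(\<lambda>s. deriv (?f s) 0) differentiable (at 0)"
      using outer real_differentiable_def by blast
  qed
  then show ?thesis
    using DERIV_imp_deriv[OF outer] by (simp add: renyi_form_def)
qed

end
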